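(* Let $n,m\in\mathbb{N}$, let $\mathcal{U}=\{u_1,\ldots,u_{|\mathcal{U}|}\}\subseteq\mathbb{Z}^n$ be finite, let $G=(V,E)$ be the directed graph with $V=\mathbb{Z}^n$ and $E=\{(x,y)\mid y-x\in\mathcal{U}\}$, and let $G_{\hat{S}}=(\hat{S},E_{\hat{S}})\subseteq G$ be a finite induced subgraph. Then the greedy labeling algorithm described in the context can be performed in $O(|E_{\hat{S}}|+|\mathcal{U}|\,m\,|\hat{S}|)$ operations.
   Context: Notation: $\mathbb{N}$ is the set of strictly positive integers, $[m]=\{1,\ldots,m\}$, $|\cdot|$ is cardinality. The induced subgraph $G_{\hat{S}}$ has vertex set $\hat{S}$ and edge set $E_{\hat{S}}=\{(x,y)\in E\mid x,y\in\hat{S}\}$ (loops are included if $0\in\mathcal{U}$). Operations are counted in a unit-cost model: each arithmetic operation or comparison on numbers, and each elementary access to the stored data of the graph $G_{\hat{S}}$, counts as one operation. Probability space: each $u\in\mathcal{U}$ receives a random label $\hat{l}(u)\in[m]$, chosen independently and uniformly, and $l:E_{\hat{S}}\to[m]$ is given by $l(x,y)=\hat{l}(y-x)$. For $x\in\hat{S}$ and $j\in[m]$, $B_x^j$ denotes the event that $j\notin l(\{(x,x')\in E_{\hat{S}}\mid x'\in\hat{S}\})$, where $l(A)$ is the image of the edge set $A$ under $l$. $\Pr$ denotes probability in this space. Greedy labeling algorithm: define labels $l_1,\ldots,l_{|\mathcal{U}|}\in[m]$ inductively, for $i=1,2,\ldots,|\mathcal{U}|$, by choosing $$l_i\in\operatorname*{argmin}_{l'\in[m]}\sum_{x\in\hat{S},\,j\in[m]}\Pr\left(B_x^j\,\middle|\,\hat{l}(u_1)=l_1,\ldots,\hat{l}(u_{i-1})=l_{i-1},\hat{l}(u_i)=l'\right)$$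 (any minimizer may be chosen). The output is the (deterministic) labeling $\hat{l}(u_i)=l_i$ for $i=1,\ldots,|\mathcal{U}|$, together with $l:E_{\hat{S}}\to[m]$ given by $l(x,y)=\hat{l}(y-x)$ for all $(x,y)\in E_{\hat{S}}$. *)

theory Defs
  imports "HOL-Probability.Probability" "Jordan_Normal_Form.Matrix"
begin

section \<open>Induced subgraphs of the graph on \<open>\<int>\<^sup>n\<close> generated by \<open>U\<close>\<close>

definition gen_edges :: "nat \<Rightarrow> int vec set \<Rightarrow> (int vec \<times> int vec) set" where
  "gen_edges n U = {(x, y). x \<in> carrier_vec n \<and> y \<in> carrier_vec n \<and> y - x \<in> U}"

definition induced_edges :: "nat \<Rightarrow> int vec set \<Rightarrow> int vec set \<Rightarrow> (int vec \<times> int vec) set" where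
  "induced_edges n U S = {(x, y) \<in> gen_edges n U. x \<in> S \<and> y \<in> S}"


section \<open>Random labels and greedy labelings\<close>

definition edge_label :: "(int vec \<Rightarrow> nat) \<Rightarrow> int vec \<times> int vec \<Rightarrow> nat" where
  "edge_label h = (\<lambda>(x, y). h (y - x))"

text \<open>
  The labels of distinct elements of \<open>U\<close> are independent and uniform on \<open>{1..m}\<close>. The value \<open>0\<close>
  is what a labeling takes outside \<open>U\<close>; it plays no role.
\<close>

definition random_label :: "nat \<Rightarrow> int vec set \<Rightarrow> (int vec \<Rightarrow> nat) pmf" where
  "random_label m U = Pi_pmf U 0 (\<lambda>_. pmf_of_set {1..m})"

definition missing ::
    "nat \<Rightarrow> int vec set \<Rightarrow> int vec set \<Rightarrow> int vec \<Rightarrow> nat \<Rightarrow> (int vec \<Rightarrow> nat) \<Rightarrow> bool" where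
  "missing n U S x j h \<longleftrightarrow>
     j \<notin> edge_label h ` {(x, x') | x'. x' \<in> S \<and> (x, x') \<in> induced_edges n U S}"

text \<open>
  \<open>U\<close> is enumerated by the list \<open>us\<close>, whose indices start at \<open>0\<close>. The value
  \<open>greedy_objective n m us S h i l'\<close> is the quantity minimised over \<open>l'\<close> when the label of
  \<open>us ! i\<close> is chosen and the earlier elements of \<open>us\<close> have received their labels under \<open>h\<close>.
\<close>

definition greedy_objective ::
    "nat \<Rightarrow> nat \<Rightarrow> int vec list \<Rightarrow> int vec set \<Rightarrow> (int vec \<Rightarrow> nat) \<Rightarrow> nat \<Rightarrow> nat \<Rightarrow> real" where
  "greedy_objective n m us S h i l' =
     (\<Sum>(x, j)\<in>S \<times> {1..m}.
        \<P>(g in random_label m (set us). missing n (set us) S x j g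
             \<bar> (\<forall>k<i. g (us ! k) = h (us ! k)) \<and> g (us ! i) = l'))"

definition greedy_labeling ::
    "nat \<Rightarrow> nat \<Rightarrow> int vec list \<Rightarrow> int vec set \<Rightarrow> (int vec \<Rightarrow> nat) \<Rightarrow> bool" where
  "greedy_labeling n m us S h \<longleftrightarrow>
     (\<forall>i<length us.
        is_arg_min (greedy_objective n m us S h i) (\<lambda>l'. l' \<in> {1..m}) (h (us ! i)))"


section \<open>Unit-cost machine\<close>

text \<open>
  Programs work on rational numbers held in named registers and in named arrays indexed by
  natural numbers. Every instruction performs at most one arithmetic operation or one
  array access and costs 1, and so does every evaluation of a branch or loop condition.
  There is no rounding operation: an array access is possible only if the index is a
  natural number, and otherwise execution is stuck, as it is on division by zero.
\<close>

record store =
  reg :: "string \<Rightarrow> rat"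
  arr :: "string \<Rightarrow> nat \<Rightarrow> rat"

datatype operand = Const rat | Reg string

datatype aop = Add | Sub | Mul | Div

datatype com =
    Skip
  | Arith string aop operand operand
  | Load string string operand
  | Store string operand operand
  | Seq com com
  | IfLess operand operand com com
  | WhileLess operand operand com

fun val :: "store \<Rightarrow> operand \<Rightarrow> rat" where
  "val s (Const c) = c"
| "val s (Reg r) = reg s r"

fun arith :: "aop \<Rightarrow> rat \<Rightarrow> rat \<Rightarrow> rat" where
  "arith Add a b = a + b"
| "arith Sub a b = a - b"
| "arith Mul a b = a * b"
| "arith Div a b = a / b"

definition set_reg :: "string \<Rightarrow> rat \<Rightarrow> store \<Rightarrow> store" where
  "set_reg r v s = s\<lparr>reg := (reg s)(r := v)\<rparr>"

definition set_arr :: "string \<Rightarrow> nat \<Rightarrow> rat \<Rightarrow> store \<Rightarrow> store" where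
  "set_arr A k v s = s\<lparr>arr := (arr s)(A := (arr s A)(k := v))\<rparr>"

text \<open>
  \<open>exec c s t s'\<close>: started in \<open>s\<close>, the program \<open>c\<close> halts in \<open>s'\<close> after \<open>t\<close> operations.
\<close>

inductive exec :: "com \<Rightarrow> store \<Rightarrow> nat \<Rightarrow> store \<Rightarrow> bool" where
  Skip: "exec Skip s 0 s"
| Arith: "(f = Div \<Longrightarrow> val s b \<noteq> 0) \<Longrightarrow>
    exec (Arith r f a b) s 1 (set_reg r (arith f (val s a) (val s b)) s)"
| Load: "val s a = of_nat k \<Longrightarrow> exec (Load r A a) s 1 (set_reg r (arr s A k) s)"
| Store: "val s a = of_nat k \<Longrightarrow> exec (Store A a b) s 1 (set_arr A k (val s b) s)"
| Seq: "exec c1 s t1 s1 \<Longrightarrow> exec c2 s1 t2 s2 \<Longrightarrow> exec (Seq c1 c2) s (t1 + t2) s2"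
| IfTrue: "val s a < val s b \<Longrightarrow> exec c1 s t s' \<Longrightarrow> exec (IfLess a b c1 c2) s (t + 1) s'"
| IfFalse: "\<not> val s a < val s b \<Longrightarrow> exec c2 s t s' \<Longrightarrow> exec (IfLess a b c1 c2) s (t + 1) s'"
| WhileFalse: "\<not> val s a < val s b \<Longrightarrow> exec (WhileLess a b c) s 1 s"
| WhileTrue: "val s a < val s b \<Longrightarrow> exec c s t1 s1 \<Longrightarrow> exec (WhileLess a b c) s1 t2 s2 \<Longrightarrow>
    exec (WhileLess a b c) s (t1 + t2 + 1) s2"

inductive_cases SkipE: "exec Skip s t s'"
  and ArithE: "exec (Arith r f a b) s t s'"
  and LoadE: "exec (Load r A a) s t s'"
  and StoreE: "exec (Store A a b) s t s'"
  and SeqE: "exec (Seq c1 c2) s t s'"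
  and IfLessE: "exec (IfLess a b c1 c2) s t s'"
  and WhileLessE: "exec (WhileLess a b c) s t s'"

lemma exec_deterministic:
  "exec c s t s' \<Longrightarrow> exec c s u s'' \<Longrightarrow> u = t \<and> s'' = s'"
proof (induction arbitrary: u s'' rule: exec.induct)
  case (Skip s)
  then show ?case by (auto elim: SkipE)
next
  case (Arith f s b r a)
  from Arith.prems show ?case by (rule ArithE) simp
next
  case (Load s a k r A)
  from Load.prems show ?case by (rule LoadE) (use Load.hyps in simp)
next
  case (Store s a k A b)
  from Store.prems show ?case by (rule StoreE) (use Store.hyps in simp)
next
  case (Seq c1 s t1 s1 c2 t2 s2)
  from Seq.prems obtain u1 r u2
    where e: "exec c1 s u1 r" "exec c2 r u2 s''" and u: "u = u1 + u2"
    by (rule SeqE) simp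
  from Seq.IH(1)[OF e(1)] have "u1 = t1" "r = s1" by simp_all
  with Seq.IH(2)[of u2 s''] e(2) u show ?case by simp
next
  case (IfTrue s a b c1 t s' c2)
  from IfTrue.prems IfTrue.hyps obtain v where e: "exec c1 s v s''" and u: "u = v + 1"
    by (auto elim: IfLessE)
  from IfTrue.IH[OF e] u show ?case by simp
next
  case (IfFalse s a b c2 t s' c1)
  from IfFalse.prems IfFalse.hyps obtain v where e: "exec c2 s v s''" and u: "u = v + 1"
    by (auto elim: IfLessE)
  from IfFalse.IH[OF e] u show ?case by simp
next
  case (WhileFalse s a b c)
  from WhileFalse.prems show ?case by (rule WhileLessE) (use WhileFalse.hyps in simp_all)
next
  case (WhileTrue s a b c t1 s1 t2 s2)
  from WhileTrue.prems obtain u1 r u2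
    where e: "exec c s u1 r" "exec (WhileLess a b c) r u2 s''" and u: "u = u1 + u2 + 1"
    using WhileTrue.hyps(1) by cases auto
  from WhileTrue.IH(1)[OF e(1)] have "u1 = t1" "r = s1" by simp_all
  with WhileTrue.IH(2)[of u2 s''] e(2) u show ?case by simp
qed


section \<open>Input and output of the labeling program\<close>

text \<open>
  The subgraph is stored as an unsorted list of edges. Vertices are represented by their position
  in \<open>vs\<close> and elements of \<open>U\<close> by their position in \<open>us\<close>. For each edge \<open>(x, y)\<close> the arrays hold
  its tail, its head and the element \<open>y - x\<close> of \<open>U\<close> that generates it. The dimension does not
  occur: coordinates are not part of the stored data. All other registers and array cells are
  arbitrary at the start.
\<close>

definition stores_graph ::
    "nat \<Rightarrow> int vec list \<Rightarrow> int vec list \<Rightarrow> (int vec \<times> int vec) list \<Rightarrow> store \<Rightarrow> bool" where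
  "stores_graph m us vs es s \<longleftrightarrow>
     reg s ''m'' = of_nat m \<and>
     reg s ''gens'' = of_nat (length us) \<and>
     reg s ''vertices'' = of_nat (length vs) \<and>
     reg s ''edges'' = of_nat (length es) \<and>
     (\<forall>e<length es. \<exists>a<length vs. \<exists>b<length vs. \<exists>k<length us.
        es ! e = (vs ! a, vs ! b) \<and> vs ! b - vs ! a = us ! k \<and>
        arr s ''tail'' e = of_nat a \<and>
        arr s ''head'' e = of_nat b \<and>
        arr s ''gen'' e = of_nat k)"

definition stores_labeling ::
    "int vec list \<Rightarrow> (int vec \<times> int vec) list \<Rightarrow> (int vec \<Rightarrow> nat) \<Rightarrow> store \<Rightarrow> bool" where
  "stores_labeling us es h s \<longleftrightarrow>
     (\<forall>i<length us. arr s ''genlabel'' i = of_nat (h (us ! i))) \<and>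
     (\<forall>e<length es. arr s ''edgelabel'' e = of_nat (edge_label h (es ! e)))"

end

(* For x in S, the probability that x misses the label j, given labels of the first i generators, is
   0 if j already occurs at x, and otherwise (1 - 1/m)^r, where r is the number of out-edges of x
   whose generator is still unlabelled. A candidate label l for the generator u changes only the
   summands (x, l) with x + u in S. Minimising the objective therefore means maximising the sum,
   over these x at which l does not occur yet, of the current weight (1 - 1/m)^r of x. Keeping the
   weights and the occurrences in tables, one score costs O(|S|) operations, and updating a weight
   is a division by 1 - 1/m. *)

theory Submission
  imports Defs
begin

section \<open>Weakest preconditions with running time\<close>

text \<open>The machine and the probabilities meet only in \<open>maximal_score\<close>: the program
  is shown to produce labels satisfying it, and such labels are shown to minimise the objective. The
  powers of \<open>1 - 1/m\<close> come from independence: the out-edges of one vertex have distinct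
  generators, so the conditional probability factors over \<open>U\<close>. All weights are
  rational, hence scores are computed and compared exactly; the passage to real probabilities is the
  cast \<open>of_rat\<close>. The delicate case is \<open>m = 1\<close>, where
  \<open>1 - 1/m\<close> vanishes and a weight could not be updated by division. Only one label
  exists there, so \<open>factor\<close> may use the base 1 instead. Setting up the tables costs
  multiples of \<open>L * N\<close>, \<open>N\<close> and \<open>N * m\<close>. These and the
  constants are absorbed by \<open>L * m * N\<close> only if neither \<open>U\<close> nor
  \<open>S\<close> is empty; otherwise there are no edges either, and the bound is zero. This is the
  case that the statement exempts.\<close>

definition wp :: "com \<Rightarrow> store \<Rightarrow> (nat \<Rightarrow> store \<Rightarrow> bool) \<Rightarrow> bool" where
  "wp c s Q \<longleftrightarrow> (\<exists>t s'. exec c s t s' \<and> Q t s')"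

lemma wp_Skip [simp]: "wp Skip s Q \<longleftrightarrow> Q 0 s"
  unfolding wp_def by (blast intro: exec.Skip elim: SkipE)

lemma wp_Arith [simp]:
  "wp (Arith r f a b) s Q \<longleftrightarrow>
    (f = Div \<longrightarrow> val s b \<noteq> 0) \<and> Q 1 (set_reg r (arith f (val s a) (val s b)) s)"
  unfolding wp_def by (auto intro!: exI exec.Arith elim!: ArithE)

lemma exec_Load_iff:
  "exec (Load r A a) s t s' \<longleftrightarrow>
    (\<exists>k. val s a = of_nat k \<and> t = 1 \<and> s' = set_reg r (arr s A k) s)"
  by (auto intro: exec.Load[simplified] elim!: LoadE)

lemma exec_Store_iff:
  "exec (Store A a b) s t s' \<longleftrightarrow>
    (\<exists>k. val s a = of_nat k \<and> t = 1 \<and> s' = set_arr A k (val s b) s)"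
  by (auto intro: exec.Store[simplified] elim!: StoreE)

lemma wp_Load [simp]:
  "wp (Load r A a) s Q \<longleftrightarrow> (\<exists>k. val s a = of_nat k \<and> Q 1 (set_reg r (arr s A k) s))"
  unfolding wp_def exec_Load_iff by auto

lemma wp_Store [simp]:
  "wp (Store A a b) s Q \<longleftrightarrow> (\<exists>k. val s a = of_nat k \<and> Q 1 (set_arr A k (val s b) s))"
  unfolding wp_def exec_Store_iff by auto

lemma wp_Seq [simp]:
  "wp (Seq c1 c2) s Q \<longleftrightarrow> wp c1 s (\<lambda>t1 s1. wp c2 s1 (\<lambda>t2 s2. Q (t1 + t2) s2))"
  unfolding wp_def by (blast intro: exec.Seq elim: SeqE)

lemma exec_IfLess_iff:
  "exec (IfLess a b c1 c2) s t s' \<longleftrightarrow>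
    (\<exists>u. t = u + 1 \<and> exec (if val s a < val s b then c1 else c2) s u s')"
  by (auto elim!: IfLessE intro: exec.IfTrue[simplified] exec.IfFalse[simplified])

lemma exec_WhileLess_iff:
  "exec (WhileLess a b c) s t s' \<longleftrightarrow>
    (if val s a < val s b
     then \<exists>t1 s1 t2. t = t1 + t2 + 1 \<and> exec c s t1 s1 \<and> exec (WhileLess a b c) s1 t2 s'
     else t = 1 \<and> s' = s)"
  by (rule iffI, erule WhileLessE)
    (auto intro: exec.WhileTrue[simplified] exec.WhileFalse[simplified] split: if_splits)

lemma wp_IfLess [simp]:
  "wp (IfLess a b c1 c2) s Q \<longleftrightarrow>
    (if val s a < val s b then wp c1 s (\<lambda>t. Q (t + 1)) else wp c2 s (\<lambda>t. Q (t + 1)))"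
  unfolding wp_def exec_IfLess_iff by auto

text \<open>This equation is not a simp rule because the loop recurs on its right-hand side;
  \<open>wp_For\<close> unfolds it once per iteration.\<close>

lemma wp_WhileLess:
  "wp (WhileLess a b c) s Q \<longleftrightarrow>
    (if val s a < val s b
     then wp c s (\<lambda>t1 s1. wp (WhileLess a b c) s1 (\<lambda>t2. Q (t1 + t2 + 1))) else Q 1 s)"
  unfolding wp_def exec_WhileLess_iff[of a b c s]
  by (cases "val s a < val s b") (auto, blast)

lemma wp_mono: "wp c s P \<Longrightarrow> (\<And>t s'. P t s' \<Longrightarrow> Q t s') \<Longrightarrow> wp c s Q"
  unfolding wp_def by blast

section \<open>Frame conditions\<close>

fun written_regs :: "com \<Rightarrow> string set" where
  "written_regs Skip = {}"
| "written_regs (Arith r f a b) = {r}"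
| "written_regs (Load r A a) = {r}"
| "written_regs (Store A a b) = {}"
| "written_regs (Seq c1 c2) = written_regs c1 \<union> written_regs c2"
| "written_regs (IfLess a b c1 c2) = written_regs c1 \<union> written_regs c2"
| "written_regs (WhileLess a b c) = written_regs c"

fun written_arrs :: "com \<Rightarrow> string set" where
  "written_arrs Skip = {}"
| "written_arrs (Arith r f a b) = {}"
| "written_arrs (Load r A a) = {}"
| "written_arrs (Store A a b) = {A}"
| "written_arrs (Seq c1 c2) = written_arrs c1 \<union> written_arrs c2"
| "written_arrs (IfLess a b c1 c2) = written_arrs c1 \<union> written_arrs c2"
| "written_arrs (WhileLess a b c) = written_arrs c"

text \<open>A syntactic frame: loop invariants then only have to speak of what the body assigns, and
  the rest is carried over from the state before the loop.\<close>

definition unchanged :: "com \<Rightarrow> store \<Rightarrow> store \<Rightarrow> bool" where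
  "unchanged c s s' \<longleftrightarrow>
    (\<forall>r. r \<notin> written_regs c \<longrightarrow> reg s' r = reg s r) \<and>
    (\<forall>A. A \<notin> written_arrs c \<longrightarrow> arr s' A = arr s A)"

lemma reg_set_reg [simp]: "reg (set_reg r v s) = (reg s)(r := v)"
  and arr_set_reg [simp]: "arr (set_reg r v s) = arr s"
  and reg_set_arr [simp]: "reg (set_arr A k v s) = reg s"
  and arr_set_arr [simp]: "arr (set_arr A k v s) = (arr s)(A := (arr s A)(k := v))"
  by (simp_all add: set_reg_def set_arr_def)

lemma exec_unchanged: "exec c s t s' \<Longrightarrow> unchanged c s s'"
  by (induction rule: exec.induct) (auto simp: unchanged_def)

lemma wp_frame: "wp c s P \<Longrightarrow> wp c s (\<lambda>t s'. P t s' \<and> unchanged c s s')"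
  unfolding wp_def using exec_unchanged by blast

section \<open>Counted loops and row-major tables\<close>

fun block :: "com list \<Rightarrow> com" where
  "block [] = Skip"
| "block (c # cs) = Seq c (block cs)"

definition For :: "string \<Rightarrow> string \<Rightarrow> com \<Rightarrow> com" where
  "For r b c = Seq (Arith r Add (Const 0) (Const 0))
     (WhileLess (Reg r) (Reg b) (Seq c (Arith r Add (Reg r) (Const 1))))"

lemma written_regs_For [simp]: "written_regs (For r b c) = insert r (written_regs c)"
  and written_arrs_For [simp]: "written_arrs (For r b c) = written_arrs c"
  by (auto simp: For_def)

text \<open>Each iteration pays \<open>k\<close> for the body and 2 for the test and the increment;
  the final 2 are the initial assignment and the failing test. In \<open>step\<close> the frame
  refers to the state before the loop, so facts about the input need not enter the
  invariant.\<close>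

lemma wp_For:
  assumes bound: "reg s b = of_nat N" "b \<noteq> r" "r \<notin> written_regs c" "b \<notin> written_regs c"
    and init: "I 0 (set_reg r 0 s)"
    and step: "\<And>i s'. i < N \<Longrightarrow> I i s' \<Longrightarrow> reg s' r = of_nat i \<Longrightarrow> unchanged (For r b c) s s' \<Longrightarrow>
      wp c s' (\<lambda>t s''. t \<le> k \<and> I (Suc i) (set_reg r (of_nat (Suc i)) s''))"
  shows "wp (For r b c) s (\<lambda>t s'. t \<le> (k + 2) * N + 2 \<and> I N s' \<and> unchanged (For r b c) s s')"
proof -
  let ?c = "Seq c (Arith r Add (Reg r) (Const 1))"
  \<comment> \<open>Induction on the number of iterations left; the extra 1 pays for the failing
    test.\<close>
  have loop: "wp (WhileLess (Reg r) (Reg b) ?c) s'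
      (\<lambda>t s''. t \<le> (k + 2) * (N - i) + 1 \<and> I N s'')"
    if "i \<le> N" "I i s'" "reg s' r = of_nat i" "unchanged (For r b c) s s'" for i s'
    using that
  proof (induction "N - i" arbitrary: i s')
    case 0
    then have "reg s' b = of_nat N" "i = N" using bound by (auto simp: unchanged_def)
    with 0 show ?case by (subst wp_WhileLess) auto
  next
    case (Suc d)
    from Suc.prems bound have b: "reg s' b = of_nat N" by (auto simp: unchanged_def)
    from Suc.hyps have i: "i < N" by simp
    have "wp ?c s' (\<lambda>t1 s1. wp (WhileLess (Reg r) (Reg b) ?c) s1
        (\<lambda>t2 s2. t1 + t2 + 1 \<le> (k + 2) * (N - i) + 1 \<and> I N s2))"
      unfolding wp_Seq
    proof (rule wp_mono, rule wp_frame, rule step[OF i Suc.prems(2-4)])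
      fix t s1
      assume *: "(t \<le> k \<and> I (Suc i) (set_reg r (of_nat (Suc i)) s1)) \<and> unchanged c s' s1"
      let ?s1 = "set_reg r (of_nat (Suc i)) s1"
      have r: "reg s1 r = of_nat i"
        using * bound Suc.prems by (simp add: unchanged_def)
      have u: "unchanged (For r b c) s ?s1"
        using * Suc.prems(4) by (simp add: unchanged_def)
      have "wp (WhileLess (Reg r) (Reg b) ?c) ?s1
          (\<lambda>t s''. t \<le> (k + 2) * (N - Suc i) + 1 \<and> I N s'')"
        using * i Suc.hyps u by (intro Suc.hyps(1)) auto
      then have "wp (WhileLess (Reg r) (Reg b) ?c) ?s1
          (\<lambda>t2 s2. t + 1 + t2 + 1 \<le> (k + 2) * (N - i) + 1 \<and> I N s2)"
      proof (rule wp_mono)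
        fix t2 s2 assume "t2 \<le> (k + 2) * (N - Suc i) + 1 \<and> I N s2"
        moreover have "(k + 2) * (N - i) = (k + 2) * (N - Suc i) + (k + 2)"
        proof -
          from Suc.hyps(2) have "N - i = Suc d" "N - Suc i = d" by simp_all
          then show ?thesis by simp
        qed
        ultimately show "t + 1 + t2 + 1 \<le> (k + 2) * (N - i) + 1 \<and> I N s2"
          using * by linarith
      qed
      then show "wp (Arith r Add (Reg r) (Const 1)) s1
          (\<lambda>ta sa. wp (WhileLess (Reg r) (Reg b) ?c) sa
          (\<lambda>t2 s2. t + ta + t2 + 1 \<le> (k + 2) * (N - i) + 1 \<and> I N s2))"
        by (simp add: r add.commute[of 1])
    qed
    then show ?case
      using i b Suc.prems(3) by (subst wp_WhileLess) simp
  qed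
  have "wp (For r b c) s (\<lambda>t s'. t \<le> (k + 2) * N + 2 \<and> I N s')"
    unfolding For_def
    using loop[of 0 "set_reg r 0 s"] init
    by (auto simp: unchanged_def elim: wp_mono)
  from wp_frame[OF this] show ?thesis by (rule wp_mono) auto
qed

text \<open>Division by the row length recovers the row, so distinct pairs never share a cell and a
  store leaves all other entries intact.\<close>

lemma cell_eq_iff:
  fixes x y :: nat
  assumes "x < N" "y < N"
  shows "i * N + x = k * N + y \<longleftrightarrow> i = k \<and> x = y"
proof
  assume eq: "i * N + x = k * N + y"
  have "(i * N + x) div N = i" "(k * N + y) div N = k" using assms by simp_all
  with eq show "i = k \<and> x = y" by simp
qed simp

lemma cell_less:
  fixes i N :: nat
  assumes "i < L" "x < N"
  shows "i * N + x < L * N"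
proof -
  have "i * N + x < Suc i * N" using assms by simp
  also have "\<dots> \<le> L * N" using assms by (intro mult_le_mono1) simp
  finally show ?thesis .
qed

text \<open>Addresses are computed in rational arithmetic, while \<open>wp_Load\<close> and
  \<open>wp_Store\<close> ask for a natural index. The form \<open>k = ...\<close> lets the
  simplifier eliminate that existential quantifier.\<close>

lemma of_nat_cell_eq [simp]:
  "of_nat i * of_nat N + of_nat x = (of_nat k :: rat) \<longleftrightarrow> k = i * N + x"
  unfolding of_nat_mult[symmetric] of_nat_add[symmetric] of_nat_eq_iff by auto

definition fill :: "string \<Rightarrow> string \<Rightarrow> rat \<Rightarrow> com" where
  "fill A b v = For ''k'' b (Store A (Reg ''k'') (Const v))"

lemma wp_fill:
  assumes "reg s b = of_nat N" "b \<noteq> ''k''"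
  shows "wp (fill A b v) s
    (\<lambda>t s'. t \<le> 3 * N + 2 \<and> (\<forall>k<N. arr s' A k = v) \<and> unchanged (fill A b v) s s')"
  unfolding fill_def
  by (rule wp_mono, rule wp_For[where k = 1 and N = N and I = "\<lambda>i s. \<forall>k<i. arr s A k = v"])
    (use assms in \<open>auto simp: less_Suc_eq\<close>)

section \<open>Scores\<close>

text \<open>\<open>T x k\<close> is to mean that an edge with generator \<open>k\<close> leaves
  vertex \<open>x\<close>; there is at most one, so counting generators counts edges. The range
  starts at \<open>i\<close> itself: the generator about to be labelled still counts as
  unlabelled.\<close>

definition weight :: "rat \<Rightarrow> nat \<Rightarrow> (nat \<Rightarrow> nat \<Rightarrow> bool) \<Rightarrow> nat \<Rightarrow> nat \<Rightarrow> rat" where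
  "weight q L T i x = q ^ card {k \<in> {i..<L}. T x k}"

definition unhit :: "(nat \<Rightarrow> nat \<Rightarrow> bool) \<Rightarrow> (nat \<Rightarrow> nat) \<Rightarrow> nat \<Rightarrow> nat \<Rightarrow> nat \<Rightarrow> bool" where
  "unhit T lab i x l \<longleftrightarrow> (\<forall>k<i. T x k \<longrightarrow> lab k \<noteq> l)"

definition score ::
    "rat \<Rightarrow> nat \<Rightarrow> nat \<Rightarrow> (nat \<Rightarrow> nat \<Rightarrow> bool) \<Rightarrow> (nat \<Rightarrow> nat) \<Rightarrow> nat \<Rightarrow> nat \<Rightarrow> rat" where
  "score q N L T lab i l =
    (\<Sum>x<N. of_bool (T x i) * weight q L T i x * of_bool (unhit T lab i x l))"

definition maximal_score ::
    "rat \<Rightarrow> nat \<Rightarrow> nat \<Rightarrow> nat \<Rightarrow> (nat \<Rightarrow> nat \<Rightarrow> bool) \<Rightarrow> (nat \<Rightarrow> nat) \<Rightarrow> nat \<Rightarrow> bool" where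
  "maximal_score q m N L T lab i \<longleftrightarrow>
    lab i < m \<and> (\<forall>l<m. score q N L T lab i l \<le> score q N L T lab i (lab i))"

lemma weight_Suc:
  assumes "i < L" "q \<noteq> 0"
  shows "weight q L T (Suc i) x = (if T x i then weight q L T i x / q else weight q L T i x)"
proof -
  have "{k \<in> {i..<L}. T x k} =
      (if T x i then insert i {k \<in> {Suc i..<L}. T x k} else {k \<in> {Suc i..<L}. T x k})"
    using assms(1) by (auto simp: Suc_le_eq le_less)
  then show ?thesis
    using assms(2) by (simp add: weight_def)
qed

lemma unhit_Suc: "unhit T lab (Suc i) x l \<longleftrightarrow> unhit T lab i x l \<and> (T x i \<longrightarrow> lab i \<noteq> l)"
  by (auto simp: unhit_def less_Suc_eq)

text \<open>Scores at stage \<open>i\<close> read only labels below \<open>i\<close>, so labels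
  chosen later can be filled in without spoiling the maximality already established.\<close>

lemma score_cong:
  assumes "\<And>k. k < i \<Longrightarrow> lab k = lab' k"
  shows "score q N L T lab i l = score q N L T lab' i l"
  using assms by (simp add: score_def unhit_def)

lemma maximal_score_cong:
  assumes "\<And>k. k \<le> i \<Longrightarrow> lab k = lab' k"
  shows "maximal_score q m N L T lab i \<longleftrightarrow> maximal_score q m N L T lab' i"
  using assms score_cong[of i lab lab'] by (simp add: maximal_score_def)

text \<open>
  For \<open>m = 1\<close> there is only one label to choose from, and any nonzero value makes the divisions by
  \<open>factor m\<close> in the program legal.
\<close>

definition factor :: "nat \<Rightarrow> rat" where
  "factor m = (if m = 1 then 1 else 1 - 1 / of_nat m)"

lemma factor_pos: "0 < m \<Longrightarrow> 0 < factor m"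
  by (simp add: factor_def)

section \<open>The program and its running time\<close>

definition init_factor :: com where
  "init_factor = IfLess (Const 1) (Reg ''m'')
     (block [Arith ''q'' Div (Const 1) (Reg ''m''), Arith ''q'' Sub (Const 1) (Reg ''q'')])
     (Arith ''q'' Add (Const 1) (Const 0))"

text \<open>The initial content of the tables is arbitrary, so they are set cell by cell. Rows of
  \<open>out\<close> belong to generators, those of \<open>unhit\<close> to vertices;
  \<open>cells\<close> holds the two sizes in turn.\<close>

definition init_tables :: com where
  "init_tables = block
    [Arith ''cells'' Mul (Reg ''gens'') (Reg ''vertices''),
     fill ''out'' ''cells'' 0,
     fill ''weight'' ''vertices'' 1,
     Arith ''cells'' Mul (Reg ''vertices'') (Reg ''m''),
     fill ''unhit'' ''cells'' 1]"

text \<open>One multiplication by \<open>q\<close> per edge builds the power with the out-degree as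
  exponent, at constant cost and without any search for neighbours.\<close>

definition read_edges :: com where
  "read_edges = For ''e'' ''edges'' (block
    [Load ''x'' ''tail'' (Reg ''e''),
     Load ''k'' ''gen'' (Reg ''e''),
     Arith ''cell'' Mul (Reg ''k'') (Reg ''vertices''),
     Arith ''cell'' Add (Reg ''cell'') (Reg ''x''),
     Store ''out'' (Reg ''cell'') (Const 1),
     Load ''v'' ''weight'' (Reg ''x''),
     Arith ''v'' Mul (Reg ''v'') (Reg ''q''),
     Store ''weight'' (Reg ''x'') (Reg ''v'')])"

text \<open>Table entries enter as 0/1 factors rather than through branches, so each iteration adds
  exactly one summand of \<open>score\<close>.\<close>

definition compute_score :: com where
  "compute_score = For ''x'' ''vertices'' (block
    [Arith ''cell'' Mul (Reg ''i'') (Reg ''vertices''),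
     Arith ''cell'' Add (Reg ''cell'') (Reg ''x''),
     Load ''v'' ''out'' (Reg ''cell''),
     Load ''w'' ''weight'' (Reg ''x''),
     Arith ''v'' Mul (Reg ''v'') (Reg ''w''),
     Arith ''cell'' Mul (Reg ''x'') (Reg ''m''),
     Arith ''cell'' Add (Reg ''cell'') (Reg ''l''),
     Load ''w'' ''unhit'' (Reg ''cell''),
     Arith ''v'' Mul (Reg ''v'') (Reg ''w''),
     Arith ''score'' Add (Reg ''score'') (Reg ''v'')])"

definition choose_label :: com where
  "choose_label = For ''l'' ''m'' (block
    [Arith ''score'' Add (Const 0) (Const 0),
     compute_score,
     IfLess (Reg ''best'') (Reg ''score'')
       (block [Arith ''best'' Add (Reg ''score'') (Const 0),
               Arith ''label'' Add (Reg ''l'') (Const 0)])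
       Skip])"

definition update :: com where
  "update = For ''x'' ''vertices'' (block
    [Arith ''cell'' Mul (Reg ''i'') (Reg ''vertices''),
     Arith ''cell'' Add (Reg ''cell'') (Reg ''x''),
     Load ''v'' ''out'' (Reg ''cell''),
     IfLess (Const 0) (Reg ''v'')
       (block [Load ''w'' ''weight'' (Reg ''x''),
               Arith ''w'' Div (Reg ''w'') (Reg ''q''),
               Store ''weight'' (Reg ''x'') (Reg ''w''),
               Arith ''cell'' Mul (Reg ''x'') (Reg ''m''),
               Arith ''cell'' Add (Reg ''cell'') (Reg ''label''),
               Store ''unhit'' (Reg ''cell'') (Const 0)])
       Skip])"

definition label_gens :: com where
  "label_gens = For ''i'' ''gens'' (block
    [Arith ''best'' Sub (Const 0) (Const 1),
     choose_label,
     Arith ''v'' Add (Reg ''label'') (Const 1),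
     Store ''genlabel'' (Reg ''i'') (Reg ''v''),
     update])"

definition label_edges :: com where
  "label_edges = For ''e'' ''edges'' (block
    [Load ''k'' ''gen'' (Reg ''e''),
     Load ''v'' ''genlabel'' (Reg ''k''),
     Store ''edgelabel'' (Reg ''e'') (Reg ''v'')])"

definition greedy_program :: com where
  "greedy_program = block [init_factor, init_tables, read_edges, label_gens, label_edges]"

text \<open>Vectors are replaced by positions in the lists. An edge is given by its tail and its
  generator, since these determine its head; \<open>inj\<close> is what distinctness of the edge
  list becomes.\<close>

locale edge_list =
  fixes m N L M :: nat and src gen :: "nat \<Rightarrow> nat"
  assumes m_pos: "0 < m"
    and src_less: "e < M \<Longrightarrow> src e < N"
    and gen_less: "e < M \<Longrightarrow> gen e < L"
    and inj: "e < M \<Longrightarrow> e' < M \<Longrightarrow> src e = src e' \<Longrightarrow> gen e = gen e' \<Longrightarrow> e = e'"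
begin

definition input :: "store \<Rightarrow> bool" where
  "input s \<longleftrightarrow>
    reg s ''m'' = of_nat m \<and> reg s ''gens'' = of_nat L \<and>
    reg s ''vertices'' = of_nat N \<and> reg s ''edges'' = of_nat M \<and>
    (\<forall>e<M. arr s ''tail'' e = of_nat (src e) \<and> arr s ''gen'' e = of_nat (gen e))"

definition out_before :: "nat \<Rightarrow> nat \<Rightarrow> nat \<Rightarrow> bool" where
  "out_before n x k \<longleftrightarrow> (\<exists>e<n. src e = x \<and> gen e = k)"

abbreviation "out \<equiv> out_before M"
abbreviation "q \<equiv> factor m"

text \<open>
  \<open>T\<close> holds the edges read so far and \<open>i\<close> is the number of labelled generators. Labels count
  from \<open>0\<close> here and are shifted to \<open>{1..m}\<close> on output.
\<close>

definition tables :: "(nat \<Rightarrow> nat \<Rightarrow> bool) \<Rightarrow> (nat \<Rightarrow> nat) \<Rightarrow> nat \<Rightarrow> store \<Rightarrow> bool" where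
  "tables T lab i s \<longleftrightarrow> reg s ''q'' = q \<and>
    (\<forall>k<L. \<forall>x<N. arr s ''out'' (k * N + x) = of_bool (T x k)) \<and>
    (\<forall>x<N. arr s ''weight'' x = weight q L T i x) \<and>
    (\<forall>x<N. \<forall>l<m. arr s ''unhit'' (x * m + l) = of_bool (unhit T lab i x l))"

lemma q_pos: "0 < q"
  using m_pos by (rule factor_pos)

section \<open>Correctness and cost of the phases\<close>

lemma wp_init_factor:
  assumes "input s"
  shows "wp init_factor s (\<lambda>t s'. t \<le> 3 \<and> input s' \<and> reg s' ''q'' = q)"
  using assms m_pos by (auto simp: init_factor_def input_def factor_def)

text \<open>At stage 0 no generator is labelled, so \<open>unhit\<close> holds vacuously for any
  \<open>lab\<close>; without edges every weight is an empty power.\<close>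

lemma wp_init_tables:
  assumes "input s" "reg s ''q'' = q"
  shows "wp init_tables s (\<lambda>t s'. t \<le> 3 * (L * N) + 3 * N + 3 * (N * m) + 8 \<and>
    input s' \<and> tables (out_before 0) lab 0 s')"
proof -
  let ?Q = "\<lambda>t s'. t \<le> 3 * (L * N) + 3 * N + 3 * (N * m) + 8 \<and>
    input s' \<and> tables (out_before 0) lab 0 s'"
  let ?s1 = "set_reg ''cells'' (of_nat (L * N)) s"
  have s1: "reg ?s1 ''cells'' = of_nat (L * N)" by simp
  have "wp (fill ''out'' ''cells'' 0) ?s1 (\<lambda>t2 s2.
      wp (fill ''weight'' ''vertices'' 1) s2 (\<lambda>t3 s3.
      wp (Arith ''cells'' Mul (Reg ''vertices'') (Reg ''m'')) s3 (\<lambda>t4 s4.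
      wp (fill ''unhit'' ''cells'' 1) s4 (\<lambda>t5 s5.
      ?Q (1 + (t2 + (t3 + (t4 + (t5 + 0))))) s5))))"
  proof (rule wp_mono[OF wp_fill], rule s1, simp, elim conjE)
    fix t2 s2
    assume t2: "t2 \<le> 3 * (L * N) + 2" and out: "\<forall>k<L * N. arr s2 ''out'' k = 0"
      and u2: "unchanged (fill ''out'' ''cells'' 0) ?s1 s2"
    have s2: "reg s2 ''vertices'' = of_nat N"
      using assms u2 by (simp add: input_def unchanged_def fill_def)
    show "wp (fill ''weight'' ''vertices'' 1) s2 (\<lambda>t3 s3.
      wp (Arith ''cells'' Mul (Reg ''vertices'') (Reg ''m'')) s3 (\<lambda>t4 s4.
      wp (fill ''unhit'' ''cells'' 1) s4 (\<lambda>t5 s5.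
      ?Q (1 + (t2 + (t3 + (t4 + (t5 + 0))))) s5)))"
    proof (rule wp_mono[OF wp_fill], rule s2, simp, elim conjE)
      fix t3 s3
      assume t3: "t3 \<le> 3 * N + 2" and weight: "\<forall>k<N. arr s3 ''weight'' k = 1"
        and u3: "unchanged (fill ''weight'' ''vertices'' 1) s2 s3"
      let ?s4 = "set_reg ''cells'' (of_nat (N * m)) s3"
      have s4: "reg ?s4 ''cells'' = of_nat (N * m)" by simp
      have "wp (fill ''unhit'' ''cells'' 1) ?s4 (\<lambda>t5 s5. ?Q (1 + (t2 + (t3 + (1 + (t5 + 0))))) s5)"
      proof (rule wp_mono[OF wp_fill], rule s4, simp, elim conjE)
        fix t5 s5
        assume t5: "t5 \<le> 3 * (N * m) + 2" and unhit: "\<forall>k<N * m. arr s5 ''unhit'' k = 1"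
          and u5: "unchanged (fill ''unhit'' ''cells'' 1) ?s4 s5"
        have "input s5"
          using assms(1) u2 u3 u5 by (simp add: input_def unchanged_def fill_def)
        moreover have "tables (out_before 0) lab 0 s5"
          using assms(2) u2 u3 u5 out weight unhit
          by (simp add: tables_def unchanged_def fill_def cell_less out_before_def weight_def
              unhit_def)
        ultimately show "?Q (1 + (t2 + (t3 + (1 + (t5 + 0))))) s5"
          using t2 t3 t5 by linarith
      qed
      moreover have "reg s3 ''vertices'' = of_nat N" "reg s3 ''m'' = of_nat m"
        using assms(1) u2 u3 by (simp_all add: input_def unchanged_def fill_def)
      ultimately show "wp (Arith ''cells'' Mul (Reg ''vertices'') (Reg ''m'')) s3 (\<lambda>t4 s4.
        wp (fill ''unhit'' ''cells'' 1) s4 (\<lambda>t5 s5. ?Q (1 + (t2 + (t3 + (t4 + (t5 + 0))))) s5))"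
        by simp
    qed
  qed
  moreover have "set_reg ''cells'' (reg s ''gens'' * reg s ''vertices'') s = ?s1"
    using assms(1) by (simp add: input_def)
  ultimately show ?thesis
    unfolding init_tables_def block.simps wp_Seq wp_Skip wp_Arith val.simps arith.simps by simp
qed

lemma out_before_Suc: "out_before (Suc e) x k \<longleftrightarrow> out_before e x k \<or> x = src e \<and> k = gen e"
  by (auto simp: out_before_def less_Suc_eq)

text \<open>By \<open>inj\<close> the generator of edge \<open>e\<close> has not yet occurred at its
  tail, so the exponent there grows by exactly one.\<close>

lemma weight_out_before_Suc:
  assumes "e < M"
  shows "weight q L (out_before (Suc e)) 0 x =
    (if x = src e then weight q L (out_before e) 0 x * q else weight q L (out_before e) 0 x)"
proof -
  have "\<not> out_before e (src e) (gen e)"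
    unfolding out_before_def using inj[OF _ assms] assms by (metis less_trans less_irrefl)
  moreover have "{k \<in> {0..<L}. out_before (Suc e) x k} =
      (if x = src e then insert (gen e) {k \<in> {0..<L}. out_before e x k}
       else {k \<in> {0..<L}. out_before e x k})"
    using gen_less[OF assms] by (auto simp: out_before_Suc)
  ultimately show ?thesis
    by (auto simp: weight_def)
qed

lemma wp_read_edges:
  assumes "input s" "tables (out_before 0) lab 0 s"
  shows "wp read_edges s (\<lambda>t s'. t \<le> 10 * M + 2 \<and> input s' \<and> tables out lab 0 s')"
  unfolding read_edges_def
proof (rule wp_mono, rule wp_For[where k = 8 and N = M and
      I = "\<lambda>e s. input s \<and> tables (out_before e) lab 0 s"], goal_cases)
  \<comment> \<open>Here and below, goals 1 to 4 are the side conditions on the registers, 5 is the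
    invariant on entry, 6 the iteration, and 7 the final weakening from
    \<open>wp_mono\<close>.\<close>
  case (6 e s')
  note less = src_less[OF 6(1)] gen_less[OF 6(1)]
  have regs: "arr s' ''tail'' e = of_nat (src e)" "arr s' ''gen'' e = of_nat (gen e)"
      "reg s' ''vertices'' = of_nat N" "reg s' ''q'' = q"
      "arr s' ''weight'' (src e) = weight q L (out_before e) 0 (src e)"
    using 6 less by (simp_all add: input_def tables_def)
  show ?case
    using 6(2) less
    by (simp add: 6(3) regs input_def tables_def cell_eq_iff out_before_Suc
        weight_out_before_Suc[OF 6(1)] unhit_def)
qed (use assms in \<open>auto simp: input_def tables_def\<close>)

lemma wp_compute_score:
  assumes "input s" "tables T lab i s" "i < L" "l < m" "reg s ''i'' = of_nat i"
    "reg s ''l'' = of_nat l" "reg s ''score'' = 0"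
  shows "wp compute_score s (\<lambda>t s'. t \<le> 12 * N + 2 \<and> reg s' ''score'' = score q N L T lab i l)"
  unfolding compute_score_def
proof (rule wp_mono, rule wp_For[where k = 10 and N = N and I = "\<lambda>n s. reg s ''score'' =
     (\<Sum>x<n. of_bool (T x i) * weight q L T i x * of_bool (unhit T lab i x l))"], goal_cases)
  case (6 x s')
  then show ?case
    using assms by (simp add: unchanged_def input_def tables_def)
qed (use assms in \<open>auto simp: input_def score_def\<close>)

text \<open>Scores are nonnegative, so the starting value -1 of \<open>best\<close> loses against
  candidate 0, and \<open>label\<close> is assigned in the first round whatever it held
  before.\<close>

lemma wp_choose_label:
  assumes "input s" "tables T lab i s" "i < L" "reg s ''i'' = of_nat i" "reg s ''best'' = - 1"
  shows "wp choose_label s (\<lambda>t s'. t \<le> (8 + 12 * N) * m + 2 \<and>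
    (\<exists>l'<m. reg s' ''label'' = of_nat l' \<and>
      (\<forall>l<m. score q N L T lab i l \<le> score q N L T lab i l')))"
  unfolding choose_label_def
\<comment> \<open>Per candidate: 1 for the reset, \<open>12 * N + 2\<close> for the score, and at
  most 3 for the comparison and the two copies.\<close>
proof (rule wp_mono, rule wp_For[where k = "12 * N + 6" and N = m and
      I = "\<lambda>n s. if n = 0 then reg s ''best'' = - 1 else \<exists>l'<n. reg s ''label'' = of_nat l' \<and>
        reg s ''best'' = score q N L T lab i l' \<and>
        (\<forall>l<n. score q N L T lab i l \<le> score q N L T lab i l')"], goal_cases)
  case (6 l s')
  let ?s = "set_reg ''score'' 0 s'"
  have "input ?s" "tables T lab i ?s" "reg ?s ''i'' = of_nat i" "reg ?s ''l'' = of_nat l"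
    using assms 6 by (auto simp: input_def tables_def unchanged_def compute_score_def)
  then have "wp compute_score ?s (\<lambda>t s'. t \<le> 12 * N + 2 \<and>
      reg s' ''score'' = score q N L T lab i l)"
    using assms 6 by (intro wp_compute_score) auto
  from wp_frame[OF this] show ?case
  proof (simp, elim wp_mono, goal_cases)
    case (1 t s1)
    then have eq: "reg s1 ''best'' = reg s' ''best''" "reg s1 ''label'' = reg s' ''label''"
        "reg s1 ''l'' = of_nat l"
      using 6 by (simp_all add: unchanged_def compute_score_def)
    show ?case
    proof (cases "l = 0")
      case True
      have "0 \<le> score q N L T lab i 0"
        using q_pos by (simp add: score_def weight_def sum_nonneg)
      then show ?thesis using 1 6 True eq by simp
    next
      case False
      with 6 obtain l' where "l' < l" "reg s' ''label'' = of_nat l'"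
        "reg s' ''best'' = score q N L T lab i l'"
        "\<And>k. k < l \<Longrightarrow> score q N L T lab i k \<le> score q N L T lab i l'"
        by auto
      then show ?thesis
        using 1 eq by (fastforce simp: less_Suc_eq)
    qed
  qed
qed (use assms m_pos in \<open>auto simp: input_def compute_score_def\<close>)

text \<open>Labelling generator \<open>i\<close> affects a vertex only through its own edge, so the
  sweep may go vertex by vertex. In between the tables are mixed: vertices below the counter are at
  stage \<open>Suc i\<close>, the others still at stage \<open>i\<close>.\<close>

lemma wp_update:
  assumes "input s" "tables T lab i s" "i < L" "reg s ''i'' = of_nat i"
    "reg s ''label'' = of_nat (lab i)" "lab i < m"
  shows "wp update s (\<lambda>t s'. t \<le> 12 * N + 2 \<and> tables T lab (Suc i) s')"
  unfolding update_def
proof (rule wp_mono, rule wp_For[where k = 10 and N = N and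
      I = "\<lambda>n s. (\<forall>x<N. arr s ''weight'' x = weight q L T (if x < n then Suc i else i) x) \<and>
        (\<forall>x<N. \<forall>l<m. arr s ''unhit'' (x * m + l) =
          of_bool (unhit T lab (if x < n then Suc i else i) x l))"], goal_cases)
  case (6 x s')
  then show ?case
    using assms q_pos
    by (auto simp: unchanged_def input_def tables_def less_Suc_eq cell_eq_iff weight_Suc
        unhit_Suc)
next
  case (7 t s')
  then show ?case
    using assms by (auto simp: unchanged_def tables_def)
qed (use assms in \<open>auto simp: input_def tables_def\<close>)

lemma wp_label_gens:
  assumes "input s" "tables out lab0 0 s"
  shows "wp label_gens s (\<lambda>t s'. t \<le> (9 + ((8 + 12 * N) * m + 12 * N)) * L + 2 \<and> input s' \<and>
    (\<exists>lab. \<forall>k<L. arr s' ''genlabel'' k = of_nat (Suc (lab k)) \<and>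
      maximal_score q m N L out lab k))"
  unfolding label_gens_def
proof (rule wp_mono, rule wp_For[where k = "(8 + 12 * N) * m + 12 * N + 7" and N = L and
      I = "\<lambda>n s. input s \<and> (\<exists>lab. tables out lab n s \<and>
        (\<forall>k<n. arr s ''genlabel'' k = of_nat (Suc (lab k)) \<and>
          maximal_score q m N L out lab k))"], goal_cases)
  case (6 i s')
  then obtain lab where lab: "tables out lab i s'"
    "\<And>k. k < i \<Longrightarrow> arr s' ''genlabel'' k = of_nat (Suc (lab k)) \<and>
      maximal_score q m N L out lab k"
    by blast
  let ?s = "set_reg ''best'' (- 1) s'"
  have "input ?s" "tables out lab i ?s" "reg ?s ''i'' = of_nat i"
    using 6 lab(1) by (simp_all add: input_def tables_def)
  then have choose: "wp choose_label ?s (\<lambda>t s'. t \<le> (8 + 12 * N) * m + 2 \<and>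
    (\<exists>l'<m. reg s' ''label'' = of_nat l' \<and>
      (\<forall>l<m. score q N L out lab i l \<le> score q N L out lab i l')))"
    using 6(1) by (intro wp_choose_label) auto
  show ?case
  proof (simp, rule wp_mono[OF wp_frame[OF choose]], elim conjE exE, goal_cases)
    case (1 t2 s2 l')
    \<comment> \<open>Nothing in the tables at stage \<open>i\<close> reads the label at position
      \<open>i\<close>, so they survive this change, while maximality at \<open>i\<close> now speaks
      of \<open>l'\<close>.\<close>
    define lab' where "lab' = lab(i := l')"
    note u = \<open>unchanged choose_label ?s s2\<close>
    let ?s4 = "set_arr ''genlabel'' i (of_nat (Suc l')) (set_reg ''v'' (of_nat (Suc l')) s2)"
    have regs: "reg s2 ''i'' = of_nat i" "reg s2 ''label'' = of_nat l'"
      using 1 6 by (simp_all add: unchanged_def choose_label_def compute_score_def)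
    have "tables out lab i s2"
      using lab(1) u by (simp add: tables_def unchanged_def choose_label_def compute_score_def)
    then have "tables out lab' i ?s4"
      by (simp add: tables_def unhit_def lab'_def)
    moreover have "input ?s4"
      using 6(2) u by (simp add: input_def unchanged_def choose_label_def compute_score_def)
    moreover have "reg ?s4 ''i'' = of_nat i" "reg ?s4 ''label'' = of_nat (lab' i)"
      using regs by (simp_all add: lab'_def)
    ultimately have update: "wp update ?s4 (\<lambda>t s'. t \<le> 12 * N + 2 \<and> tables out lab' (Suc i) s')"
      using 6(1) 1 by (intro wp_update) (auto simp: lab'_def)
    have max: "maximal_score q m N L out lab' k" if "k < Suc i" for k
    proof (cases "k = i")
      case True
      then show ?thesis
        using 1 score_cong[of i lab lab'] by (simp add: maximal_score_def lab'_def)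
    next
      case False
      with that have "maximal_score q m N L out lab k" using lab(2) by simp
      then show ?thesis
        using False that maximal_score_cong[of k lab lab'] by (simp add: lab'_def)
    qed
    have genlabel: "arr ?s4 ''genlabel'' k = of_nat (Suc (lab' k))" if "k < Suc i" for k
      using that lab(2)[of k] u
      by (auto simp: lab'_def unchanged_def choose_label_def compute_score_def)
    have "wp update ?s4 (\<lambda>t5 s5. Suc (t2 + Suc (Suc t5)) \<le> (8 + 12 * N) * m + 12 * N + 7 \<and>
        input (set_reg ''i'' (of_nat (Suc i)) s5) \<and>
        (\<exists>lab. tables out lab (Suc i) (set_reg ''i'' (of_nat (Suc i)) s5) \<and>
        (\<forall>k<Suc i. arr s5 ''genlabel'' k = of_nat (Suc (lab k)) \<and>
          maximal_score q m N L out lab k)))"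
    proof (rule wp_mono[OF wp_frame[OF update]], intro conjI, goal_cases)
      case (1 t5 s5)
      then show ?case using \<open>t2 \<le> (8 + 12 * N) * m + 2\<close> by linarith
    next
      case (2 t5 s5)
      then show ?case using \<open>input ?s4\<close> by (simp add: input_def unchanged_def update_def)
    next
      case (3 t5 s5)
      then have "tables out lab' (Suc i) (set_reg ''i'' (of_nat (Suc i)) s5)"
        by (simp add: tables_def)
      moreover have "arr s5 ''genlabel'' = arr ?s4 ''genlabel''"
        using 3 by (simp add: unchanged_def update_def)
      ultimately show ?case
        using max genlabel by metis
    qed
    then show ?case
      by (simp add: regs add.commute[of "of_nat l'" 1])
  qed
next
  case (7 t s')
  then show ?case by auto
qed (use assms in \<open>auto simp: input_def tables_def choose_label_def compute_score_def update_def\<close>)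

lemma wp_label_edges:
  assumes "input s"
  shows "wp label_edges s (\<lambda>t s'. t \<le> 5 * M + 2 \<and>
    (\<forall>e<M. arr s' ''edgelabel'' e = arr s ''genlabel'' (gen e)))"
  unfolding label_edges_def
  by (rule wp_mono, rule wp_For[where k = 3 and N = M and
      I = "\<lambda>n s'. \<forall>e<n. arr s' ''edgelabel'' e = arr s ''genlabel'' (gen e)"])
    (use assms in \<open>auto simp: input_def unchanged_def less_Suc_eq\<close>)

lemma wp_greedy_program:
  assumes "input s"
  shows "wp greedy_program s (\<lambda>t s'.
    (0 < L \<and> 0 < N \<longrightarrow> t \<le> 67 * (M + L * m * N)) \<and>
    (\<exists>lab. (\<forall>k<L. arr s' ''genlabel'' k = of_nat (Suc (lab k)) \<and>
        maximal_score q m N L out lab k) \<and>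
      (\<forall>e<M. arr s' ''edgelabel'' e = of_nat (Suc (lab (gen e))))))"
  unfolding greedy_program_def block.simps wp_Seq wp_Skip
proof (rule wp_mono[OF wp_init_factor[OF assms]], elim conjE,
    rule wp_mono[OF wp_init_tables[where lab = "\<lambda>_. 0"]], assumption, assumption, elim conjE,
    rule wp_mono[OF wp_read_edges], assumption, assumption, elim conjE,
    rule wp_mono[OF wp_label_gens], assumption, assumption, elim conjE exE,
    rule wp_mono[OF wp_frame[OF wp_label_edges]], assumption, elim conjE, intro conjI impI, goal_cases)
  case (1 t1 s1 t2 s2 t3 s3 t4 s4 lab t5 s5)
  \<comment> \<open>With \<open>L\<close> and \<open>N\<close> positive, \<open>X\<close> dominates
    every smaller product and 1. The phases add up to 17 in constants, 9 from the tables, 41 from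
    the labelling of generators, in all 67; the edges only need 15.\<close>
  define X where "X = L * m * N"
  have "N \<le> X" "L \<le> X" "1 \<le> X" "L * N \<le> X" "L * m \<le> X" "N * m \<le> X"
    using 1 m_pos by (simp_all add: X_def)
  moreover have "(9 + ((8 + 12 * N) * m + 12 * N)) * L = 8 * (L * m) + 12 * X + 12 * (L * N) + 9 * L"
    by (simp add: algebra_simps X_def)
  then have "t4 \<le> 8 * (L * m) + 12 * X + 12 * (L * N) + 9 * L + 2"
    using 1 by metis
  moreover note \<open>t1 \<le> 3\<close> \<open>t2 \<le> 3 * (L * N) + 3 * N + 3 * (N * m) + 8\<close>
    \<open>t3 \<le> 10 * M + 2\<close> \<open>t5 \<le> 5 * M + 2\<close>
  \<comment> \<open>Variables in place of the products make the inequality linear.\<close>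
  moreover have "t \<le> 67 * (M + X)" if "N \<le> X" "L \<le> X" "1 \<le> X" "a \<le> X" "b \<le> X" "c \<le> X"
      "t4 \<le> 8 * b + 12 * X + 12 * a + 9 * L + 2" "t2 \<le> 3 * a + 3 * N + 3 * c + 8"
      "t = t1 + (t2 + (t3 + (t4 + (t5 + 0))))" "t1 \<le> 3" "t3 \<le> 10 * M + 2" "t5 \<le> 5 * M + 2"
    for a b c t :: nat
    using that by simp
  ultimately show ?case unfolding X_def[symmetric] by blast
next
  case (2 t1 s1 t2 s2 t3 s3 t4 s4 lab t5 s5)
  then show ?case
    using gen_less by (intro exI[of _ lab]) (auto simp: unchanged_def label_edges_def)
qed

end

section \<open>Scores and conditional probabilities\<close>

text \<open>One coordinate of the product measure: \<open>d\<close> says that the generator leaves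
  the vertex in question and must avoid \<open>j\<close>, \<open>f\<close> that its label is already
  fixed.\<close>

lemma prob_label:
  assumes "0 < m" "h \<in> {1..m}" "j \<in> {1..m}"
  shows "measure_pmf.prob (pmf_of_set {1..m}) {l. (d \<longrightarrow> l \<noteq> j) \<and> (f \<longrightarrow> l = h)} =
    (if f then of_bool (d \<longrightarrow> h \<noteq> j) / real m else if d then 1 - 1 / real m else 1)"
proof -
  have "{1..m} \<inter> {l. (d \<longrightarrow> l \<noteq> j) \<and> (f \<longrightarrow> l = h)} =
    (if f then (if d \<longrightarrow> h \<noteq> j then {h} else {}) else if d then {1..m} - {j} else {1..m})"
    using assms by auto
  then show ?thesis
    using assms by (simp add: measure_pmf_of_set of_nat_diff diff_divide_distrib)
qed

text \<open>Both events are product sets, and the condition alone is the case \<open>D = {}\<close>;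
  hence the quotient can be taken factor by factor. A fixed generator in \<open>D\<close>
  contributes 0 or 1, a free one in \<open>D\<close> contributes \<open>1 - 1/m\<close>, and all
  others contribute 1.\<close>

lemma cond_prob_avoid:
  fixes h :: "int vec \<Rightarrow> nat"
  assumes "finite U" "D \<subseteq> U" "F \<subseteq> U" "0 < m" "j \<in> {1..m}" "\<And>u. u \<in> F \<Longrightarrow> h u \<in> {1..m}"
  shows "\<P>(g in random_label m U. (\<forall>u\<in>D. g u \<noteq> j) \<bar> (\<forall>u\<in>F. g u = h u)) =
    of_bool (\<forall>u\<in>D \<inter> F. h u \<noteq> j) * (1 - 1 / real m) ^ card (D - F)"
proof -
  \<comment> \<open>Outside \<open>F\<close> the values of \<open>h\<close> are arbitrary, but
    \<open>prob_label\<close> wants a label in range at every coordinate; 1 is one.\<close>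
  define h' where "h' u = (if u \<in> F then h u else 1)" for u
  have h': "h' u \<in> {1..m}" for u using assms(4,6) by (auto simp: h'_def)
  define B where "B D u = {l. (u \<in> D \<longrightarrow> l \<noteq> j) \<and> (u \<in> F \<longrightarrow> l = h' u)}" for D and u :: "int vec"
  have prob: "measure_pmf.prob (random_label m U) {g. (\<forall>u\<in>D. g u \<noteq> j) \<and> (\<forall>u\<in>F. g u = h u)} =
      (\<Prod>u\<in>U. if u \<in> F then of_bool (u \<in> D \<longrightarrow> h' u \<noteq> j) / real m
                else if u \<in> D then 1 - 1 / real m else 1)" if "D \<subseteq> U" for D
  proof -
    have "{g. (\<forall>u\<in>D. g u \<noteq> j) \<and> (\<forall>u\<in>F. g u = h u)} = Pi U (B D)"
      using that assms(3) by (auto simp: B_def h'_def Pi_iff subset_iff)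
    then have "measure_pmf.prob (random_label m U)
        {g. (\<forall>u\<in>D. g u \<noteq> j) \<and> (\<forall>u\<in>F. g u = h u)} =
        (\<Prod>u\<in>U. measure_pmf.prob (pmf_of_set {1..m}) (B D u))"
      using assms(1) by (simp add: random_label_def measure_Pi_pmf_Pi)
    also have "\<dots> = (\<Prod>u\<in>U. if u \<in> F then of_bool (u \<in> D \<longrightarrow> h' u \<noteq> j) / real m
                else if u \<in> D then 1 - 1 / real m else 1)"
      unfolding B_def using prob_label[OF assms(4) h' assms(5)] by (intro prod.cong refl)
    finally show ?thesis .
  qed
  have "\<P>(g in random_label m U. (\<forall>u\<in>D. g u \<noteq> j) \<bar> (\<forall>u\<in>F. g u = h u)) =
     (\<Prod>u\<in>U. if u \<in> F then of_bool (u \<in> D \<longrightarrow> h' u \<noteq> j) / real m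
               else if u \<in> D then 1 - 1 / real m else 1) /
     (\<Prod>u\<in>U. if u \<in> F then 1 / real m else 1)"
    using prob[OF assms(2)] prob[of "{}"] by (simp add: cond_prob_def cong: if_cong)
  also have "\<dots> = (\<Prod>u\<in>U. (if u \<in> D \<inter> F then of_bool (h u \<noteq> j) else 1) *
      (if u \<in> D - F then 1 - 1 / real m else 1))"
    unfolding prod_dividef[symmetric]
    by (rule prod.cong) (use assms(4) in \<open>auto simp: h'_def\<close>)
  also have "\<dots> = (\<Prod>u\<in>D \<inter> F. of_bool (h u \<noteq> j)) * (\<Prod>u\<in>D - F. 1 - 1 / real m)"
  proof -
    have restrict: "prod f X = (\<Prod>u\<in>U. if u \<in> X then f u else 1)" if "X \<subseteq> U"
      for f :: "int vec \<Rightarrow> real" and X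
      using prod.inter_restrict[OF assms(1), of f X] that by (simp only: Int_absorb1)
    have "(\<Prod>u\<in>D \<inter> F. of_bool (h u \<noteq> j)) =
        (\<Prod>u\<in>U. if u \<in> D \<inter> F then of_bool (h u \<noteq> j) else 1 :: real)"
      by (rule restrict) (use assms(2) in auto)
    moreover have "(\<Prod>u\<in>D - F. 1 - 1 / real m) =
        (\<Prod>u\<in>U. if u \<in> D - F then 1 - 1 / real m else 1)"
      by (rule restrict) (use assms(2) in auto)
    ultimately show ?thesis by (simp only: prod.distrib)
  qed
  also have "(\<Prod>u\<in>D \<inter> F. of_bool (h u \<noteq> j)) = (of_bool (\<forall>u\<in>D \<inter> F. h u \<noteq> j) :: real)"
    using finite_subset[OF assms(3,1)] by (auto simp: prod_zero_iff)
  finally show ?thesis by simp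
qed

lemma vec_add_diff_cancel:
  fixes x y :: "int vec"
  assumes "x \<in> carrier_vec n" "y \<in> carrier_vec n"
  shows "x + (y - x) = y" "(x + y) - x = y"
  using assms by (auto intro!: eq_vecI)

text \<open>Since \<open>y - x = u\<close> and \<open>y = x + u\<close> are equivalent in the
  carrier, the out-edges of \<open>x\<close> correspond to the generators that keep \<open>x\<close>
  inside \<open>S\<close>.\<close>

lemma missing_iff:
  assumes "U \<subseteq> carrier_vec n" "S \<subseteq> carrier_vec n" "x \<in> S"
  shows "missing n U S x j g \<longleftrightarrow> (\<forall>u\<in>{u \<in> U. x + u \<in> S}. g u \<noteq> j)"
  unfolding missing_def edge_label_def induced_edges_def gen_edges_def
  using assms vec_add_diff_cancel[of x n] by (auto 0 4 simp: image_iff subset_iff)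

lemma greedy_objective_eq:
  assumes us: "distinct us" "set us \<subseteq> carrier_vec n" and vs: "distinct vs" "set vs \<subseteq> carrier_vec n"
    and i: "i < length us"
    and h: "\<And>k. k < i \<Longrightarrow> h (us ! k) = Suc (lab k)" "\<And>k. k < i \<Longrightarrow> lab k < m"
    and l: "l < m"
    and T: "\<And>a k. a < length vs \<Longrightarrow> k < length us \<Longrightarrow> T a k \<longleftrightarrow> vs ! a + us ! k \<in> set vs"
  shows "greedy_objective n m us (set vs) h i (Suc l) =
    (\<Sum>a<length vs. \<Sum>j<m. of_bool (unhit T lab i a j \<and> (T a i \<longrightarrow> l \<noteq> j)) *
      (1 - 1 / real m) ^ card {k \<in> {Suc i..<length us}. T a k})"
proof -
  \<comment> \<open>The candidate is treated as one more fixed label, so the condition concerns the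
    generators up to and including position \<open>i\<close>.\<close>
  let ?F = "(!) us ` {..i}" and ?h = "h(us ! i := Suc l)"
  have inj: "inj_on ((!) us) {..<length us}"
    using us(1) by (simp add: inj_on_def nth_eq_iff_index_eq)
  have ne: "us ! k \<noteq> us ! i" if "k < i" for k
    using us(1) i that by (simp add: nth_eq_iff_index_eq)
  have F: "?F \<subseteq> set us" using i by auto
  have cond: "(\<forall>k<i. g (us ! k) = h (us ! k)) \<and> g (us ! i) = Suc l \<longleftrightarrow> (\<forall>u\<in>?F. g u = ?h u)" for g
    using ne by (auto simp: le_less)
  have prob: "\<P>(g in random_label m (set us). missing n (set us) (set vs) (vs ! a) (Suc j) g
        \<bar> (\<forall>k<i. g (us ! k) = h (us ! k)) \<and> g (us ! i) = Suc l) =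
      of_bool (unhit T lab i a j \<and> (T a i \<longrightarrow> l \<noteq> j)) *
      (1 - 1 / real m) ^ card {k \<in> {Suc i..<length us}. T a k}"
    if a: "a < length vs" and j: "j < m" for a j
  proof -
    let ?D = "{u \<in> set us. vs ! a + u \<in> set vs}"
    have D: "?D = (!) us ` {k. k < length us \<and> T a k}"
      using T[OF a] by (auto simp: set_conv_nth)
    have "(\<forall>u\<in>?D \<inter> ?F. ?h u \<noteq> Suc j) \<longleftrightarrow> (\<forall>k\<le>i. T a k \<longrightarrow> ?h (us ! k) \<noteq> Suc j)"
      using T[OF a] i by auto
    also have "\<dots> \<longleftrightarrow> unhit T lab i a j \<and> (T a i \<longrightarrow> l \<noteq> j)"
      using h(1) ne by (auto simp: unhit_def le_less)
    finally have 1: "(\<forall>u\<in>?D \<inter> ?F. ?h u \<noteq> Suc j) \<longleftrightarrow> unhit T lab i a j \<and> (T a i \<longrightarrow> l \<noteq> j)" .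
    have "?D - ?F = (!) us ` ({k. k < length us \<and> T a k} - {..i})"
      unfolding D by (rule inj_on_image_set_diff[OF inj, symmetric]) (use i in auto)
    also have "{k. k < length us \<and> T a k} - {..i} = {k \<in> {Suc i..<length us}. T a k}"
      by auto
    finally have 2: "card (?D - ?F) = card {k \<in> {Suc i..<length us}. T a k}"
      using inj by (simp add: card_image inj_on_subset subset_iff)
    have "\<P>(g in random_label m (set us). missing n (set us) (set vs) (vs ! a) (Suc j) g
        \<bar> (\<forall>k<i. g (us ! k) = h (us ! k)) \<and> g (us ! i) = Suc l) =
      \<P>(g in random_label m (set us). (\<forall>u\<in>?D. g u \<noteq> Suc j) \<bar> (\<forall>u\<in>?F. g u = ?h u))"
      unfolding cond using missing_iff[OF us(2) vs(2) nth_mem[OF a]] by simp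
    also have "\<dots> = of_bool (\<forall>u\<in>?D \<inter> ?F. ?h u \<noteq> Suc j) * (1 - 1 / real m) ^ card (?D - ?F)"
    proof (rule cond_prob_avoid)
      fix u assume "u \<in> ?F"
      then obtain k where k: "k \<le> i" "u = us ! k" by auto
      show "?h u \<in> {1..m}"
      proof (cases "k = i")
        case True
        then show ?thesis using k l by simp
      next
        case False
        then have "k < i" using k(1) by simp
        then show ?thesis using h[of k] ne[of k] k(2) by simp
      qed
    qed (use F j in auto)
    finally show ?thesis unfolding 1 2 .
  qed
  have "greedy_objective n m us (set vs) h i (Suc l) = (\<Sum>x\<in>set vs. \<Sum>j\<in>{1..m}.
        \<P>(g in random_label m (set us). missing n (set us) (set vs) x j g
             \<bar> (\<forall>k<i. g (us ! k) = h (us ! k)) \<and> g (us ! i) = Suc l))"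
    by (simp add: greedy_objective_def sum.cartesian_product)
  also have "\<dots> = (\<Sum>a<length vs. \<Sum>j\<in>{1..m}.
        \<P>(g in random_label m (set us). missing n (set us) (set vs) (vs ! a) j g
             \<bar> (\<forall>k<i. g (us ! k) = h (us ! k)) \<and> g (us ! i) = Suc l))"
    by (rule sum.reindex_bij_betw[symmetric]) (use vs(1) in \<open>auto intro: bij_betw_nth\<close>)
  finally show ?thesis
    using prob by (simp add: sum.atLeast1_atMost_eq)
qed

text \<open>The constant \<open>K\<close> sums over all pairs without an earlier hit, as if
  generator \<open>i\<close> had no edges; the candidate \<open>l\<close> then removes the terms
  with \<open>j = l\<close> at the tails of its edges. At those tails the stage-\<open>i\<close>
  weights used by the score carry one surplus factor, which the division takes out.\<close>

lemma greedy_objective_score: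
  assumes us: "distinct us" "set us \<subseteq> carrier_vec n" and vs: "distinct vs" "set vs \<subseteq> carrier_vec n"
    and i: "i < length us"
    and h: "\<And>k. k < i \<Longrightarrow> h (us ! k) = Suc (lab k)" "\<And>k. k < i \<Longrightarrow> lab k < m"
    and T: "\<And>a k. a < length vs \<Longrightarrow> k < length us \<Longrightarrow> T a k \<longleftrightarrow> vs ! a + us ! k \<in> set vs"
    and m: "1 < m"
  shows "\<exists>K. \<forall>l<m. greedy_objective n m us (set vs) h i (Suc l) =
    K - of_rat (score (factor m) (length vs) (length us) T lab i l) / of_rat (factor m)"
proof -
  let ?q = "of_rat (factor m) :: real"
  let ?W = "\<lambda>a. ?q ^ card {k \<in> {Suc i..<length us}. T a k}"
  have q: "1 - 1 / real m = ?q" "factor m \<noteq> 0" "?q \<noteq> 0"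
    using m by (auto simp: factor_def of_rat_diff of_rat_divide)
  have "greedy_objective n m us (set vs) h i (Suc l) =
      (\<Sum>a<length vs. \<Sum>j<m. of_bool (unhit T lab i a j) * ?W a) -
      of_rat (score (factor m) (length vs) (length us) T lab i l) / ?q" if l: "l < m" for l
  proof -
    have "greedy_objective n m us (set vs) h i (Suc l) =
      (\<Sum>a<length vs. \<Sum>j<m. of_bool (unhit T lab i a j \<and> (T a i \<longrightarrow> l \<noteq> j)) * ?W a)"
      using greedy_objective_eq[where T = T and lab = lab and h = h, OF us vs i h l T] by (simp add: q(1))
    also have "\<dots> = (\<Sum>a<length vs. \<Sum>j<m. of_bool (unhit T lab i a j) * ?W a -
        (if j = l then of_bool (T a i \<and> unhit T lab i a l) * ?W a else 0))"
      by (intro sum.cong refl) auto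
    also have "\<dots> = (\<Sum>a<length vs. \<Sum>j<m. of_bool (unhit T lab i a j) * ?W a) -
        (\<Sum>a<length vs. of_bool (T a i \<and> unhit T lab i a l) * ?W a)"
      using l by (simp add: sum_subtractf)
    also have "(\<Sum>a<length vs. of_bool (T a i \<and> unhit T lab i a l) * ?W a) =
        of_rat (score (factor m) (length vs) (length us) T lab i l) / ?q"
    proof -
      have eq: "of_bool (T a i \<and> unhit T lab i a l) * ?W a =
        of_rat (of_bool (T a i) * weight (factor m) (length us) T i a *
          of_bool (unhit T lab i a l)) / ?q" for a
        using weight_Suc[OF i q(2), of T a] q
        by (auto simp: weight_def of_rat_power of_rat_divide field_simps
          dest: arg_cong[of _ _ "of_rat :: rat \<Rightarrow> real"])
      show ?thesis
        unfolding score_def of_rat_sum sum_divide_distrib by (intro sum.cong refl eq)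
    qed
    finally show ?thesis .
  qed
  then show ?thesis by blast
qed

lemma greedy_labelingI:
  assumes us: "distinct us" "set us \<subseteq> carrier_vec n" and vs: "distinct vs" "set vs \<subseteq> carrier_vec n"
    and h: "\<And>k. k < length us \<Longrightarrow> h (us ! k) = Suc (lab k)"
    and T: "\<And>a k. a < length vs \<Longrightarrow> k < length us \<Longrightarrow> T a k \<longleftrightarrow> vs ! a + us ! k \<in> set vs"
    and max: "\<And>i. i < length us \<Longrightarrow> maximal_score (factor m) m (length vs) (length us) T lab i"
  shows "greedy_labeling n m us (set vs) h"
  unfolding greedy_labeling_def
proof (intro allI impI)
  fix i assume i: "i < length us"
  have lab: "lab i < m" using max[OF i] by (simp add: maximal_score_def)
  show "is_arg_min (greedy_objective n m us (set vs) h i) (\<lambda>l'. l' \<in> {1..m}) (h (us ! i))"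
  proof (cases "1 < m")
    case False
    with lab have "m = 1" "lab i = 0" by auto
    then show ?thesis using h[OF i] by (auto simp: is_arg_min_def)
  next
    case True
    have "\<exists>K. \<forall>l<m. greedy_objective n m us (set vs) h i (Suc l) =
        K - of_rat (score (factor m) (length vs) (length us) T lab i l) / of_rat (factor m)"
      using i h max by (intro greedy_objective_score us vs T True) (auto simp: maximal_score_def)
    then obtain K where K: "\<forall>l<m. greedy_objective n m us (set vs) h i (Suc l) =
        K - of_rat (score (factor m) (length vs) (length us) T lab i l) / of_rat (factor m)" ..
    have "greedy_objective n m us (set vs) h i (Suc (lab i)) \<le>
        greedy_objective n m us (set vs) h i l'" if l': "l' \<in> {1..m}" for l'
    proof -
      from l' obtain l where l: "l' = Suc l" "l < m" by (cases l') auto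
      then show ?thesis
        using K lab max[OF i] factor_pos[of m] True
        by (auto simp: maximal_score_def of_rat_less_eq intro!: divide_right_mono)
    qed
    then show ?thesis
      using h[OF i] lab by (force simp: is_arg_min_def not_less)
  qed
qed

theorem proposition3:
  shows "\<exists>(p :: com) (C :: nat).
    \<forall>(n :: nat) (m :: nat) (U :: int vec set) (S :: int vec set).
      n \<ge> 1 \<longrightarrow> m \<ge> 1 \<longrightarrow>
      finite U \<longrightarrow> U \<subseteq> carrier_vec n \<longrightarrow>
      finite S \<longrightarrow> S \<subseteq> carrier_vec n \<longrightarrow>
      (\<forall>us vs es s.
        distinct us \<longrightarrow> set us = U \<longrightarrow>
        distinct vs \<longrightarrow> set vs = S \<longrightarrow>
        distinct es \<longrightarrow> set es = induced_edges n U S \<longrightarrow>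
        stores_graph m us vs es s \<longrightarrow>
        (\<exists>t s' h. exec p s t s' \<and>
           greedy_labeling n m us S h \<and>
           stores_labeling us es h s' \<and>
           (0 < card (induced_edges n U S) + card U * m * card S \<longrightarrow>
              t \<le> C * (card (induced_edges n U S) + card U * m * card S))))"
proof (rule exI[of _ greedy_program], rule exI[of _ 67], intro allI impI)
  fix n m :: nat and U S :: "int vec set" and us vs es s
  assume m: "1 \<le> m" and U: "U \<subseteq> carrier_vec n" and S: "S \<subseteq> carrier_vec n"
    and us: "distinct us" "set us = U" and vs: "distinct vs" "set vs = S"
    and es: "distinct es" "set es = induced_edges n U S" and graph: "stores_graph m us vs es s"
  let ?L = "length us" and ?N = "length vs" and ?M = "length es"
  have carrier: "us ! k \<in> carrier_vec n" "vs ! a \<in> carrier_vec n" if "k < ?L" "a < ?N" for k a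
    using that U S us vs nth_mem by blast+
  \<comment> \<open>The bound on \<open>e\<close> stands under the quantifiers so that choice yields
    total functions.\<close>
  have "\<forall>e. \<exists>a b k. e < ?M \<longrightarrow> a < ?N \<and> b < ?N \<and> k < ?L \<and>
      es ! e = (vs ! a, vs ! b) \<and> vs ! b - vs ! a = us ! k \<and>
      arr s ''tail'' e = of_nat a \<and> arr s ''gen'' e = of_nat k"
    using graph unfolding stores_graph_def by meson
  from this[unfolded choice_iff] obtain src dst gen where edge: "\<And>e. e < ?M \<Longrightarrow> src e < ?N \<and> dst e < ?N \<and> gen e < ?L \<and>
      es ! e = (vs ! src e, vs ! dst e) \<and> vs ! dst e - vs ! src e = us ! gen e \<and>
      arr s ''tail'' e = of_nat (src e) \<and> arr s ''gen'' e = of_nat (gen e)"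
    by blast
  have es_nth: "es ! e = (vs ! src e, vs ! src e + us ! gen e)" if "e < ?M" for e
    using edge[OF that] carrier[of "gen e" "src e"] carrier[of "gen e" "dst e"]
      vec_add_diff_cancel(1)[of "vs ! src e" n "vs ! dst e"] by simp
  interpret edge_list m ?N ?L ?M src gen
    proof
    show "e = e'" if "e < ?M" "e' < ?M" "src e = src e'" "gen e = gen e'" for e e'
      using that es_nth[of e] es_nth[of e'] es(1) by (metis nth_eq_iff_index_eq)
  qed (use m edge in auto)
  \<comment> \<open>The converse needs that the list contains every induced edge, and that both
    enumerations are distinct, so that vectors determine their indices.\<close>
  have out: "out a k \<longleftrightarrow> vs ! a + us ! k \<in> set vs" if "a < ?N" "k < ?L" for a k
  proof
    assume "out a k"
    then obtain e where e: "e < ?M" "src e = a" "gen e = k" by (auto simp: out_before_def)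
    then show "vs ! a + us ! k \<in> set vs"
      using edge[of e] es_nth[of e] by (metis nth_mem prod.inject)
  next
    assume "vs ! a + us ! k \<in> set vs"
    then have "(vs ! a, vs ! a + us ! k) \<in> set es"
      using that carrier[of k a] vec_add_diff_cancel(2)[of "vs ! a" n "us ! k"] us(2) vs(2)
      by (simp add: es(2) induced_edges_def gen_edges_def) (metis nth_mem)
    then obtain e where e: "e < ?M" "es ! e = (vs ! a, vs ! a + us ! k)"
      by (auto simp: in_set_conv_nth)
    then have "vs ! src e = vs ! a" and "vs ! src e + us ! gen e = vs ! a + us ! k"
      using es_nth by auto
    then have "us ! gen e = us ! k"
      using carrier[of "gen e" a] carrier[of k a] edge[OF e(1)] that
        vec_add_diff_cancel(2)[of "vs ! a" n] by metis
    then have "src e = a" "gen e = k"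
      using \<open>vs ! src e = vs ! a\<close> us(1) vs(1) that edge[OF e(1)]
      by (simp_all add: nth_eq_iff_index_eq)
    then show "out a k" using e(1) by (auto simp: out_before_def)
  qed
  have "input s"
    using graph edge by (simp add: input_def stores_graph_def)
  from wp_greedy_program[OF this] obtain t s' lab where exec: "exec greedy_program s t s'"
    and time: "0 < ?L \<and> 0 < ?N \<Longrightarrow> t \<le> 67 * (?M + ?L * m * ?N)"
    and lab: "\<And>k. k < ?L \<Longrightarrow> arr s' ''genlabel'' k = of_nat (Suc (lab k))"
      "\<And>k. k < ?L \<Longrightarrow> maximal_score q m ?N ?L out lab k"
      "\<And>e. e < ?M \<Longrightarrow> arr s' ''edgelabel'' e = of_nat (Suc (lab (gen e)))"
    unfolding wp_def by blast
  \<comment> \<open>Labels belong to positions for the machine but to vectors in the statement;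
    distinctness of \<open>us\<close> makes the position unique.\<close>
  define h where "h u = Suc (lab (inv_into {..<?L} ((!) us) u))" for u
  have h: "h (us ! k) = Suc (lab k)" if "k < ?L" for k
    using that us(1) by (simp add: h_def inv_into_f_f inj_on_def nth_eq_iff_index_eq)
  have "greedy_labeling n m us S h"
    using greedy_labelingI[of us n vs h lab out m] us vs U S h out lab(2) by simp
  moreover have "stores_labeling us es h s'"
    using lab h edge by (simp add: stores_labeling_def edge_label_def)
  moreover have "0 < card (induced_edges n U S) + card U * m * card S \<longrightarrow>
      t \<le> 67 * (card (induced_edges n U S) + card U * m * card S)"
  proof
    assume pos: "0 < card (induced_edges n U S) + card U * m * card S"
    have card: "card (induced_edges n U S) = ?M" "card U = ?L" "card S = ?N"
      using us vs es distinct_card by metis+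
    \<comment> \<open>If the product is zero, there is an edge, and its tail and generator witness
      that both lists are nonempty.\<close>
    have "0 < ?L \<and> 0 < ?N"
      using pos edge[of 0] unfolding card by fastforce
    then show "t \<le> 67 * (card (induced_edges n U S) + card U * m * card S)"
      using time card by simp
  qed
  ultimately have "exec greedy_program s t s' \<and> greedy_labeling n m us S h \<and>
      stores_labeling us es h s' \<and> (0 < card (induced_edges n U S) + card U * m * card S \<longrightarrow>
        t \<le> 67 * (card (induced_edges n U S) + card U * m * card S))"
    using exec by simp
  then show "\<exists>t s' h. exec greedy_program s t s' \<and> greedy_labeling n m us S h \<and>
      stores_labeling us es h s' \<and> (0 < card (induced_edges n U S) + card U * m * card S \<longrightarrow>
        t \<le> 67 * (card (induced_edges n U S) + card U * m * card S))"
    by (intro exI)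
qed

end
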